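(* Let $p\in\mathcal{H}_1$ and let $\beta$ be a real number. Then each of the following subordinations is sufficient for $p(z)\prec e^z$: (a) $p(z)+\beta zp'(z)\prec e^z$, where $\beta\ge e^2+1$ $(\approx 8.38906)$; (b) $p(z)+\beta\dfrac{zp'(z)}{p(z)}\prec e^z$, where $\beta\ge e+e^{-1}$ $(\approx 3.08616)$.
   Context: $\mathbb{D}=\{z\in\mathbb{C}:|z|<1\}$. $\mathcal{H}_1$ is the class of analytic functions on $\mathbb{D}$ of the form $p(z)=1+a_1z+a_2z^2+\cdots$. For functions $F,G$ analytic in $\mathbb{D}$, $F\prec G$ (F is subordinate to G) means there is an analytic $w:\mathbb{D}\to\mathbb{C}$ with $w(0)=0$, $|w(z)|<1$ and $F(z)=G(w(z))$ for all $z\in\mathbb{D}$; writing $F\prec G$ presupposes that $F$ and $G$ are analytic in $\mathbb{D}$. *)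

theory Defs
  imports "HOL-Complex_Analysis.Complex_Analysis"
begin

abbreviation unit_disc :: "complex set" where
  "unit_disc \<equiv> ball 0 1"

definition class_H1 :: "(complex \<Rightarrow> complex) set" where
  "class_H1 = {p. p holomorphic_on unit_disc \<and>
     (\<exists>a :: nat \<Rightarrow> complex. a 0 = 1 \<and> (\<forall>z\<in>unit_disc. (\<lambda>n. a n * z ^ n) sums p z))}"

text \<open>
  Analyticity of both functions is part of the relation. In particular, since
  division is total in HOL, a subordination whose left-hand side is a quotient
  such as \<open>p z + \<beta> * (z * deriv p z / p z)\<close> with \<open>p \<in> class_H1\<close> still entails
  \<open>p z \<noteq> 0\<close> on the disc when \<open>\<beta> \<noteq> 0\<close>: at a zero of \<open>p\<close> the quotient would have
  a pole, and assigning a value at that point does not make it holomorphic.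
\<close>

definition subordinate :: "(complex \<Rightarrow> complex) \<Rightarrow> (complex \<Rightarrow> complex) \<Rightarrow> bool"
    (infix "\<prec>\<^sub>s" 50) where
  "F \<prec>\<^sub>s G \<longleftrightarrow> F holomorphic_on unit_disc \<and> G holomorphic_on unit_disc \<and>
     (\<exists>w. w holomorphic_on unit_disc \<and> w 0 = 0 \<and>
        (\<forall>z\<in>unit_disc. norm (w z) < 1 \<and> F z = G (w z)))"

end

theory Submission
  imports Defs
begin

text \<open>
  If \<open>p\<close> leaves \<open>exp ` unit_disc\<close>, let \<open>z\<close> be a point of least modulus at which it does.
  Then \<open>p z = exp w\<close> with \<open>\<bar>w\<bar> = 1\<close>, and Jack's lemma applied to \<open>Ln \<circ> p\<close> shows that
  \<open>K = cnj w * (z * p' z / p z)\<close> satisfies \<open>Re K \<ge> 1\<close>. At \<open>z\<close> the two differential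
  expressions are \<open>exp w * (1 + \<beta> * w * K)\<close> and \<open>exp w + \<beta> * w * K\<close>. Both have modulus at
  least \<open>e\<close>, so they lie outside \<open>exp ` unit_disc\<close>.
\<close>

text \<open>Since 1 < pi, the closed unit disc lies in the strip where the principal logarithm
  inverts \<open>exp\<close>. So \<open>exp\<close> is injective there and \<open>Ln\<close> is
  holomorphic at every point of the image.\<close>

lemma Ln_exp_cball:
  assumes "norm w \<le> 1"
  shows "Ln (exp w) = w" and "exp w \<notin> \<real>\<^sub>\<le>\<^sub>0"
proof -
  have "\<bar>Im w\<bar> \<le> 1"
    using assms abs_Im_le_cmod[of w] by linarith
  then have Im: "- pi < Im w" "Im w < pi"
    using pi_gt3 by linarith+
  then show *: "Ln (exp w) = w"
    by (intro Ln_exp) auto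
  show "exp w \<notin> \<real>\<^sub>\<le>\<^sub>0"
  proof
    assume "exp w \<in> \<real>\<^sub>\<le>\<^sub>0"
    then obtain r where r: "exp w = of_real r" "r \<le> 0"
      by (auto elim: nonpos_Reals_cases)
    \<comment> \<open>On the negative axis the principal argument is pi, whereas \<open>Im w\<close>
      stays below pi; \<open>r = 0\<close> is excluded because \<open>exp\<close> has no
      zeros.\<close>
    have "Im (Ln (exp w)) = pi"
      using r by (metis Im_Ln_eq_pi Im_complex_of_real Re_complex_of_real exp_not_eq_zero
          less_eq_real_def of_real_0)
    then show False
      using * Im by simp
  qed
qed

lemma norm_exp_lt_exp_1: "norm w < 1 \<Longrightarrow> norm (exp w) < exp 1" for w :: complex
  using complex_Re_le_cmod[of w] by simp

text \<open>By Schwarz's lemma \<open>Re (cnj (g 1) * g t) \<le> t\<close> on \<open>[0, 1)\<close>, with equality at \<open>1\<close>.\<close>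

lemma Jack_lemma_at_1:
  assumes holo: "g holomorphic_on ball 0 1" and g0: "g 0 = 0"
    and bound: "\<And>z. norm z < 1 \<Longrightarrow> norm (g z) < 1"
    and deriv: "(g has_field_derivative d) (at 1)" and g1: "norm (g 1) = 1"
  shows "Re (cnj (g 1) * d) \<ge> 1"
proof (rule ccontr)
  assume "\<not> ?thesis"
  then have neg: "Re (cnj (g 1) * d) - 1 < 0"
    by simp
  define \<phi> where "\<phi> t = Re (cnj (g 1) * g (of_real t)) - t" for t :: real
  have "((\<lambda>t. cnj (g 1) * g (of_real t)) has_vector_derivative cnj (g 1) * d) (at 1)"
    by (rule has_vector_derivative_real_field)
       (use deriv in \<open>auto intro!: derivative_eq_intros\<close>)
  then have "((\<lambda>t. Re (cnj (g 1) * g (of_real t))) has_real_derivative Re (cnj (g 1) * d)) (at 1)"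
    by (simp only: has_vector_derivative_complex_iff)
  then have "(\<phi> has_real_derivative (Re (cnj (g 1) * d) - 1)) (at 1)"
    unfolding \<phi>_def by (rule DERIV_diff[OF _ DERIV_ident])
  from DERIV_neg_dec_left[OF this neg]
  obtain e where e: "e > 0" "\<And>h. 0 < h \<Longrightarrow> h < e \<Longrightarrow> \<phi> 1 < \<phi> (1 - h)"
    by blast
  \<comment> \<open>Halving \<open>e\<close> keeps the step strictly below \<open>e\<close>; the cap
    1/2 keeps \<open>t\<close> positive.\<close>
  define t where "t = 1 - min (e/2) (1/2)"
  have t: "0 < t" "t < 1" and inc: "\<phi> 1 < \<phi> t"
    using e(2)[of "min (e/2) (1/2)"] \<open>e > 0\<close> by (auto simp: t_def min_def)
  have "cnj (g 1) * g 1 = 1"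
    using complex_norm_square[of "g 1"] g1 by (simp add: mult.commute)
  then have "\<phi> 1 = 0"
    by (simp add: \<phi>_def)
  moreover have "norm (g (of_real t)) \<le> norm (of_real t :: complex)"
    by (rule Schwarz_Lemma(1)[OF holo g0]) (use bound t in auto)
  then have "norm (cnj (g 1) * g (of_real t)) \<le> t"
    using t g1 by (simp add: norm_mult)
  then have "\<phi> t \<le> 0"
    using complex_Re_le_cmod[of "cnj (g 1) * g (of_real t)"] by (simp add: \<phi>_def)
  ultimately show False
    using inc by simp
qed

text \<open>Injectivity of \<open>exp\<close> on the disc reduces subordination to containment of
  ranges: \<open>Ln (p z)\<close> serves as the Schwarz function, and it vanishes at 0 because
  \<open>p 0 = 1\<close>.\<close>

lemma subordinate_expI:
  assumes holo: "p holomorphic_on unit_disc" and p0: "p 0 = 1"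
    and range: "\<And>z. z \<in> unit_disc \<Longrightarrow> p z \<in> exp ` unit_disc"
  shows "p \<prec>\<^sub>s exp"
proof -
  have slit: "p z \<notin> \<real>\<^sub>\<le>\<^sub>0" and bound: "norm (Ln (p z)) < 1" and eq: "p z = exp (Ln (p z))"
    if "z \<in> unit_disc" for z
    using range[OF that] Ln_exp_cball by (auto simp: less_imp_le)
  have "(\<lambda>z. Ln (p z)) holomorphic_on unit_disc"
    using holo slit by (intro holomorphic_intros) auto
  then show ?thesis
    unfolding subordinate_def using holo p0 bound eq
    by (auto intro!: exI[of _ "\<lambda>z. Ln (p z)"] holomorphic_intros)
qed

text \<open>Both parts of the theorem start from this point: failure of the subordination becomes
  one inequality at one point, independent of the differential expression.\<close>

lemma not_subordinate_exp_boundary_point: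
  assumes holo: "p holomorphic_on unit_disc" and p0: "p 0 = 1" and nsub: "\<not> p \<prec>\<^sub>s exp"
  obtains z w where "z \<in> unit_disc" "norm w = 1" "p z = exp w"
    "Re (cnj w * (z * deriv p z / p z)) \<ge> 1"
proof -
  let ?\<Omega> = "exp ` unit_disc"
  obtain z1 where z1: "norm z1 < 1" "p z1 \<notin> ?\<Omega>"
    using subordinate_expI[OF holo p0] nsub by auto
  have "inj_on exp unit_disc"
    by (rule inj_on_inverseI[of _ Ln]) (auto intro: Ln_exp_cball less_imp_le)
  then have "open ?\<Omega>"
    by (intro open_mapping_thm3) (auto intro: holomorphic_intros)
  \<comment> \<open>Openness of the image makes \<open>S\<close> compact, so the least modulus is
    attained. The radius \<open>norm z1\<close> keeps \<open>S\<close> within the open disc, where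
    \<open>p\<close> is continuous.\<close>
  define S where "S = cball 0 (norm z1) \<inter> p -` (- ?\<Omega>)"
  have sub: "cball 0 (norm z1) \<subseteq> unit_disc"
    using z1 by auto
  have "closed S"
    unfolding S_def using \<open>open ?\<Omega>\<close> holo sub
    by (intro continuous_closed_preimage)
       (auto intro: holomorphic_on_imp_continuous_on holomorphic_on_subset)
  then have "compact S"
    by (simp add: S_def compact_eq_bounded_closed bounded_Int)
  moreover have "z1 \<in> S"
    using z1 by (auto simp: S_def)
  ultimately obtain z where "z \<in> S" and least: "\<And>y. y \<in> S \<Longrightarrow> norm z \<le> norm y"
    using continuous_attains_inf[of S norm] by (auto intro: continuous_intros)
  have z: "norm z \<le> norm z1" "norm z < 1" "p z \<notin> ?\<Omega>"
    using \<open>z \<in> S\<close> sub by (auto simp: S_def)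
  have inside: "p y \<in> ?\<Omega>" if "norm y < norm z" for y
    using least[of y] that z by (auto simp: S_def)
  have "z \<noteq> 0"
    using z(3) p0 by (auto intro: image_eqI[of _ _ 0])
  have cont: "isCont p z"
    using holo z(2) by (intro continuous_on_interior[of unit_disc] holomorphic_on_imp_continuous_on)
      (auto simp: interior_open)
  \<comment> \<open>Along the radius towards \<open>z\<close>, minimality keeps the values of
    \<open>p\<close> in the open image; their limit stays in the compact image of the closed
    disc.\<close>
  have "p z \<in> exp ` cball 0 1"
  proof (rule Lim_in_closed_set)
    show "closed (exp ` cball (0::complex) 1)"
      by (intro compact_imp_closed compact_continuous_image continuous_intros compact_cball)
    have "((\<lambda>t. of_real t * z) \<longlongrightarrow> of_real 1 * z) (at_left (1::real))"
      by (intro tendsto_intros)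
    then show "((\<lambda>t. p (of_real t * z)) \<longlongrightarrow> p z) (at_left (1::real))"
      using isCont_tendsto_compose[OF cont] by simp
    have "\<forall>\<^sub>F t in at_left (1::real). t \<in> {0<..<1}"
      by (intro eventually_at_leftI[of 0]) auto
    then show "\<forall>\<^sub>F t in at_left (1::real). p (of_real t * z) \<in> exp ` cball 0 1"
    proof eventually_elim
      case (elim t)
      then have "norm (of_real t * z) < norm z"
        using \<open>z \<noteq> 0\<close> by (simp add: norm_mult)
      from inside[OF this] show ?case
        by (auto simp: less_imp_le)
    qed
  qed simp
  then obtain w where w: "p z = exp w" "norm w \<le> 1"
    by auto
  with z(3) have "norm w = 1"
    by force
  \<comment> \<open>Rescaling moves \<open>z\<close> to 1, and the chain rule turns the derivative
    at 1 into \<open>z * deriv p z / p z\<close>.\<close>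
  define g where "g \<zeta> = Ln (p (z * \<zeta>))" for \<zeta>
  have in_ball: "norm (z * \<zeta>) < norm z" if "norm \<zeta> < 1" for \<zeta>
    using that \<open>z \<noteq> 0\<close> by (simp add: norm_mult)
  have g: "norm (g \<zeta>) < 1" "p (z * \<zeta>) \<notin> \<real>\<^sub>\<le>\<^sub>0" if "norm \<zeta> < 1" for \<zeta>
    using inside[OF in_ball[OF that]] Ln_exp_cball by (auto simp: g_def less_imp_le)
  have "(\<lambda>\<zeta>. p (z * \<zeta>)) holomorphic_on unit_disc"
  proof (rule holomorphic_on_compose_gen[OF _ holo, unfolded o_def])
    show "(*) z ` unit_disc \<subseteq> unit_disc"
      using in_ball z(2) by force
  qed (intro holomorphic_intros)
  then have "g holomorphic_on unit_disc"
    unfolding g_def using g(2) by (intro holomorphic_intros) auto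
  moreover have "g 0 = 0"
    by (simp add: g_def p0)
  \<comment> \<open>Although 1 is on the boundary of the disc, \<open>g\<close> is differentiable
    there: \<open>z\<close> is an interior point and \<open>p z = exp w\<close> avoids the
    cut.\<close>
  moreover have "(g has_field_derivative z * deriv p z / p z) (at 1)"
  proof -
    have "(p has_field_derivative deriv p z) (at (z * 1))"
      using holomorphic_derivI[OF holo, of z] z(2) by simp
    moreover have "p (z * 1) \<notin> \<real>\<^sub>\<le>\<^sub>0"
      using Ln_exp_cball(2)[OF w(2)] w(1) by simp
    ultimately show ?thesis
      unfolding g_def
      by (auto intro!: derivative_eq_intros DERIV_chain2[of p] simp: field_simps)
  qed
  moreover have g1: "g 1 = w"
    using Ln_exp_cball(1)[OF w(2)] w(1) by (simp add: g_def)
  ultimately have "Re (cnj w * (z * deriv p z / p z)) \<ge> 1"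
    using Jack_lemma_at_1[of g "z * deriv p z / p z"] g(1) \<open>norm w = 1\<close> by metis
  with that[of z w] z(2) w(1) \<open>norm w = 1\<close> show thesis
    by simp
qed

lemma subordinate_exp_norm_lt: "F \<prec>\<^sub>s exp \<Longrightarrow> z \<in> unit_disc \<Longrightarrow> norm (F z) < exp 1"
  unfolding subordinate_def by (metis norm_exp_lt_exp_1)

text \<open>With \<open>w = x + i y\<close> the real part is
  \<open>exp x * (x * cos y + y * sin y)\<close>. For \<bar>y\<bar> \<le> 1 the sine term is
  nonnegative and the cosine lies in [0, 1], which leaves the minimum of \<open>x * exp x\<close>,
  attained at \<open>x = -1\<close>. Equality holds at \<open>w = -1\<close>.\<close>

lemma Re_cnj_mult_exp_ge:
  assumes "norm w = 1"
  shows "Re (cnj w * exp w) \<ge> - exp (- 1)"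
proof -
  define x y where "x = Re w" and "y = Im w"
  have "\<bar>y\<bar> \<le> 1"
    using abs_Im_le_cmod[of w] assms by (simp add: y_def)
  then have "\<bar>y\<bar> \<le> pi / 2"
    using pi_gt3 by linarith
  then have cos: "0 \<le> cos y"
    using cos_ge_zero[of y] by simp
  have sin: "0 \<le> y * sin y"
    using sin_ge_zero[of y] sin_ge_zero[of "- y"] \<open>\<bar>y\<bar> \<le> pi / 2\<close>
    by (cases "y \<ge> 0") (auto simp: mult_nonneg_nonneg mult_nonpos_nonpos)
  have "min x 0 \<le> x * cos y"
    using cos cos_le_one[of y] mult_left_le[of "cos y" "- x"] by (cases "x \<ge> 0") auto
  then have "exp x * (x * cos y + y * sin y) \<ge> exp x * min x 0"
    using sin by (intro mult_left_mono) auto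
  moreover have "- exp (- 1) \<le> exp x * min x 0"
  proof -
    \<comment> \<open>This is \<open>1 + u \<le> exp u\<close> at \<open>u = - x - 1\<close>, the
      tangent at the minimum \<open>x = -1\<close>.\<close>
    have "exp x * (- x) \<le> exp x * exp (- x - 1)"
      using exp_ge_add_one_self[of "- x - 1"] by (intro mult_left_mono) auto
    also have "\<dots> = exp (- 1)"
      by (simp flip: exp_add)
    finally show ?thesis
      by (auto simp: min_def)
  qed
  moreover have "Re (cnj w * exp w) = exp x * (x * cos y + y * sin y)"
    by (simp add: x_def y_def Re_exp Im_exp algebra_simps)
  ultimately show ?thesis
    by linarith
qed

theorem theorem4p4:
  fixes p :: "complex \<Rightarrow> complex" and \<beta> :: real
  assumes "p \<in> class_H1"
  shows "(\<beta> \<ge> exp 1 ^ 2 + 1 \<and>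
            (\<lambda>z. p z + of_real \<beta> * z * deriv p z) \<prec>\<^sub>s exp
          \<longrightarrow> p \<prec>\<^sub>s exp)
       \<and> (\<beta> \<ge> exp 1 + exp (- 1) \<and>
            (\<lambda>z. p z + of_real \<beta> * (z * deriv p z / p z)) \<prec>\<^sub>s exp
          \<longrightarrow> p \<prec>\<^sub>s exp)"
proof -
  have holo: "p holomorphic_on unit_disc"
    using assms by (simp add: class_H1_def)
  obtain a where a: "a 0 = 1" "\<forall>z\<in>unit_disc. (\<lambda>n. a n * z ^ n) sums p z"
    using assms by (auto simp: class_H1_def)
  then have "(\<lambda>n. a n * 0 ^ n) sums p 0"
    by (metis centre_in_ball zero_less_one)
  \<comment> \<open>At 0 the power series reduces to its constant term, as
    \<open>0 ^ 0 = 1\<close>.\<close>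
  then have p0: "p 0 = 1"
    using a(1) sums_unique2[OF powser_sums_zero[of a]] by metis
  show ?thesis
  proof (intro conjI impI; elim conjE; rule ccontr)
    assume \<beta>: "\<beta> \<ge> exp 1 ^ 2 + 1"
      and sub: "(\<lambda>z. p z + of_real \<beta> * z * deriv p z) \<prec>\<^sub>s exp" and "\<not> p \<prec>\<^sub>s exp"
    then obtain z w where z: "z \<in> unit_disc" "norm w = 1" "p z = exp w"
      and Re: "Re (cnj w * (z * deriv p z / p z)) \<ge> 1"
      using not_subordinate_exp_boundary_point[OF holo p0] by blast
    define L where "L = z * deriv p z / p z"
    have "1 \<le> norm (cnj w * L)"
      using Re complex_Re_le_cmod[of "cnj w * L"] unfolding L_def by linarith
    then have "1 \<le> norm L"
      using z(2) by (simp add: norm_mult)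
    then have "\<beta> * 1 \<le> \<beta> * norm L"
      using \<beta> by (intro mult_left_mono) (auto intro: order_trans[rotated])
    moreover have "norm (of_real \<beta> * L) = \<bar>\<beta>\<bar> * norm L"
      by (simp add: norm_mult)
    moreover have "\<beta> \<ge> 0"
      using \<beta> by (auto intro: order_trans[rotated])
    \<comment> \<open>By the reverse triangle inequality the modulus is at least \<beta> - 1, which
      explains the summand 1 in the threshold. The square of \<open>exp 1\<close> then compensates
      for \<open>norm (exp w)\<close> possibly being as small as \<open>exp (- 1)\<close>.\<close>
    ultimately have "exp 1 ^ 2 \<le> norm (1 + of_real \<beta> * L)"
      using \<beta> norm_diff_ineq[of "of_real \<beta> * L" 1] by (simp add: add.commute)
    moreover have "exp (- 1) \<le> norm (exp w)"
      using abs_Re_le_cmod[of w] z(2) by simp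
    ultimately have "exp (- 1) * exp 1 ^ 2 \<le> norm (exp w) * norm (1 + of_real \<beta> * L)"
      by (intro mult_mono) auto
    moreover have "exp (- 1) * exp 1 ^ 2 = (exp 1 :: real)"
      by (simp add: power2_eq_square flip: exp_add)
    moreover have "p z + of_real \<beta> * z * deriv p z = exp w * (1 + of_real \<beta> * L)"
      by (simp add: L_def z(3) field_simps)
    ultimately show False
      using subordinate_exp_norm_lt[OF sub z(1)] by (simp add: norm_mult)
  next
    assume \<beta>: "\<beta> \<ge> exp 1 + exp (- 1)"
      and sub: "(\<lambda>z. p z + of_real \<beta> * (z * deriv p z / p z)) \<prec>\<^sub>s exp" and "\<not> p \<prec>\<^sub>s exp"
    then obtain z w where z: "z \<in> unit_disc" "norm w = 1" "p z = exp w"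
      and Re: "Re (cnj w * (z * deriv p z / p z)) \<ge> 1"
      using not_subordinate_exp_boundary_point[OF holo p0] by blast
    define L where "L = z * deriv p z / p z"
    have "\<beta> \<ge> 0"
      using \<beta> exp_gt_zero[of 1] exp_gt_zero[of "- 1 :: real"] by linarith
    then have "\<beta> * 1 \<le> \<beta> * Re (cnj w * L)"
      using Re by (intro mult_left_mono) (auto simp: L_def)
    \<comment> \<open>Rotation by the unimodular \<open>cnj w\<close> preserves the modulus and
      makes both real parts controllable: the first is at least \<open>- exp (- 1)\<close>, the
      second at least \<beta>, so the threshold leaves exactly \<open>exp 1\<close>.\<close>
    moreover have "Re (cnj w * (exp w + of_real \<beta> * L)) = Re (cnj w * exp w) + \<beta> * Re (cnj w * L)"
      by (simp add: algebra_simps)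
    ultimately have "exp 1 \<le> Re (cnj w * (exp w + of_real \<beta> * L))"
      using Re_cnj_mult_exp_ge[OF z(2)] \<beta> by linarith
    also have "\<dots> \<le> norm (cnj w * (exp w + of_real \<beta> * L))"
      by (rule complex_Re_le_cmod)
    also have "\<dots> = norm (exp w + of_real \<beta> * L)"
      by (simp add: norm_mult z(2))
    finally show False
      using subordinate_exp_norm_lt[OF sub z(1)] by (simp add: L_def z(3))
  qed
qed

end
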